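(* Let $G=(V,E)$ be the side information graph of an index coding problem and let $e\in E$. If there exists a subset $S\subseteq V$ such that the vertex induced subgraph $G|_S$ is a unicycle and $e$ is an edge of $G|_S$, then $e$ is critical, i.e., removing $e$ from $G$ strictly reduces the capacity region.
   Context: Index coding problem: let $n\ge 1$ and $[1:n]=\{1,\dots,n\}$. An index coding problem is specified by side information subsets $A_1,\dots,A_n$ with $A_j\subseteq[1:n]\setminus\{j\}$, or equivalently by its side information graph $G=(V,E)$, the directed graph (no self-loops, no parallel edges) with $V=[1:n]$ and an edge $i\to j$ if and only if $i\in A_j$. Index code: for nonnegative integers $t_1,\dots,t_n$ and a positive integer $r$, a $(t_1,\dots,t_n,r)$ index code for $G$ consists of an encoder $\phi:\prod_{i=1}^n\{0,1\}^{t_i}\to\{0,1\}^r$ and decoders $\psi_j:\{0,1\}^r\times\prod_{k\in A_j}\{0,1\}^{t_k}\to\{0,1\}^{t_j}$, $j\in[1:n]$, such that $\psi_j(\phi(x^n),(x_k)_{k\in A_j})=x_j$ for all $j\in[1:n]$ and all $x^n=(x_1,\dots,x_n)\in\prod_{i=1}^n\{0,1\}^{t_i}$. Capacity region: a tuple $(R_1,\dots,R_n)$ of nonnegative reals is achievable for $G$ if there exists a $(t_1,\dots,t_n,r)$ index code for $G$ with $R_j\le t_j/r$ for all $j\in[1:n]$. The capacity region of $G$ is the closure of the set of achievable rate tuples. Critical edge: an edge $e\in E$ is critical if the capacity region of $G_e:=(V,E\setminus\{e\})$ is a proper subset of the capacity region of $G$. For $S\subseteq V$, $G|_S$ denotes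 the vertex induced subgraph on $S$. Unicycle: a directed graph is a unicycle if its edge set is a Hamiltonian cycle of it, i.e., its edges are exactly the edges of a single directed cycle visiting every vertex exactly once. Directed cycles have length at least $2$; a pair of opposite edges $i\to j$, $j\to i$ is a directed cycle of length $2$. *)

theory Defs
  imports "HOL-Analysis.Analysis" "Graph_Theory.Digraph_Component"
begin

text \<open>Side information of receiver \<open>j\<close>: the tails of the arcs into \<open>j\<close>.\<close>

definition side_info :: "('v, 'e) pre_digraph \<Rightarrow> 'v \<Rightarrow> 'v set" where
  "side_info G j = {i. (i, j) \<in> arcs_ends G}"

lemma (in digraph) side_info_subset: "side_info G j \<subseteq> verts G - {j}"
  unfolding side_info_def using adj_in_verts adj_not_same by fastforce

definition bits :: "nat \<Rightarrow> bool list set" where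
  "bits k = {w. length w = k}"

definition messages :: "'v set \<Rightarrow> ('v \<Rightarrow> nat) \<Rightarrow> ('v \<Rightarrow> bool list) set" where
  "messages A t = (\<Pi>\<^sub>E i\<in>A. bits (t i))"

definition index_code ::
  "('v, 'e) pre_digraph \<Rightarrow> ('v \<Rightarrow> nat) \<Rightarrow> nat \<Rightarrow> (('v \<Rightarrow> bool list) \<Rightarrow> bool list) \<Rightarrow>
   ('v \<Rightarrow> bool list \<times> ('v \<Rightarrow> bool list) \<Rightarrow> bool list) \<Rightarrow> bool" where
  "index_code G t r \<phi> \<psi> \<longleftrightarrow>
     r > 0 \<and>
     \<phi> \<in> Pi (messages (verts G) t) (\<lambda>_. bits r) \<and>
     (\<forall>j\<in>verts G. \<psi> j \<in> Pi (bits r \<times> messages (side_info G j) t) (\<lambda>_. bits (t j))) \<and>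
     (\<forall>j\<in>verts G. \<forall>x\<in>messages (verts G) t. \<psi> j (\<phi> x, restrict x (side_info G j)) = x j)"

text \<open>Rate tuples are extensional functions on the vertex set, i.e. points of
  \<open>topspace (product_topology (\<lambda>_. euclideanreal) (verts G))\<close>. For a finite vertex set this
  space is the Euclidean space with coordinates indexed by the vertices.\<close>

definition achievable :: "('v, 'e) pre_digraph \<Rightarrow> ('v \<Rightarrow> real) \<Rightarrow> bool" where
  "achievable G R \<longleftrightarrow>
     R \<in> (\<Pi>\<^sub>E j\<in>verts G. {0..}) \<and>
     (\<exists>t r \<phi> \<psi>. index_code G t r \<phi> \<psi> \<and> (\<forall>j\<in>verts G. R j \<le> real (t j) / real r))"

definition capacity_region :: "('v, 'e) pre_digraph \<Rightarrow> ('v \<Rightarrow> real) set" where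
  "capacity_region G =
     product_topology (\<lambda>_. euclideanreal) (verts G) closure_of {R. achievable G R}"

definition critical :: "('v, 'e) pre_digraph \<Rightarrow> 'e \<Rightarrow> bool" where
  "critical G e \<longleftrightarrow>
     e \<in> arcs G \<and> capacity_region (pre_digraph.del_arc G e) \<subset> capacity_region G"

text \<open>A cycle in the sense of \<open>pre_digraph.cycle\<close> repeats no vertex but may be a single loop,
  hence the bound on the length.\<close>

definition unicycle :: "('v, 'e) pre_digraph \<Rightarrow> bool" where
  "unicycle H \<longleftrightarrow>
     (\<exists>p. pre_digraph.cycle H p \<and> length p \<ge> 2 \<and> set p = arcs H \<and> tail H ` set p = verts H)"

end

theory Submission
  imports Defs
begin

text \<open>On the cycle \<open>S\<close> of length \<open>k\<close>, sending the \<open>k - 1\<close> sums of consecutive one-bit messages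
  serves every receiver, so the tuple equal to \<open>1 / (k - 1)\<close> on \<open>S\<close> and \<open>0\<close> elsewhere lies in the
  capacity region of \<open>G\<close>. Without \<open>e\<close> the graph induced on \<open>S\<close> is acyclic, so once the messages
  outside \<open>S\<close> are fixed the codeword determines those in \<open>S\<close> one after the other. Hence the rates
  on \<open>S\<close> sum to at most \<open>1\<close>, a closed condition violated by the sum \<open>k / (k - 1)\<close>.\<close>

section \<open>Decodability as a condition on the encoder alone\<close>

text \<open>Decoder \<open>j\<close> may pick any message tuple consistent with the codeword and the
  side information: by the last assumption all candidates have the same entry at \<open>j\<close>.
  Codes can thus be built by giving only the encoder.\<close>

lemma index_codeI_decodable:
  assumes "r > 0"
    and "\<phi> \<in> Pi (messages (verts G) t) (\<lambda>_. bits r)"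
    and dec: "\<And>j x y. \<lbrakk>j \<in> verts G; x \<in> messages (verts G) t; y \<in> messages (verts G) t; \<phi> x = \<phi> y;
        \<And>i. i \<in> side_info G j \<Longrightarrow> x i = y i\<rbrakk> \<Longrightarrow> x j = y j"
  shows "\<exists>\<psi>. index_code G t r \<phi> \<psi>"
proof -
  let ?P = "\<lambda>j m z x. x \<in> messages (verts G) t \<and> \<phi> x = m \<and> restrict x (side_info G j) = z"
  \<comment> \<open>The all-False default keeps \<open>\<psi> j\<close> inside
    \<open>bits (t j)\<close> on pairs that no message tuple produces.\<close>
  define \<psi> where "\<psi> j mz = (if \<exists>x. ?P j (fst mz) (snd mz) x
     then (SOME x. ?P j (fst mz) (snd mz) x) j else replicate (t j) False)" for j mz
  have "\<psi> j mz \<in> bits (t j)" if j: "j \<in> verts G" for j mz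
  proof (cases "\<exists>x. ?P j (fst mz) (snd mz) x")
    case True
    from someI_ex[OF this] have "(SOME x. ?P j (fst mz) (snd mz) x) \<in> messages (verts G) t" by blast
    with True j show ?thesis by (auto simp: \<psi>_def messages_def PiE_def Pi_def)
  qed (auto simp: \<psi>_def bits_def simp del: not_ex)
  moreover have "\<psi> j (\<phi> x, restrict x (side_info G j)) = x j"
    if j: "j \<in> verts G" and x: "x \<in> messages (verts G) t" for j x
  proof -
    define y where "y = (SOME y. ?P j (\<phi> x) (restrict x (side_info G j)) y)"
    have ex: "\<exists>y. ?P j (\<phi> x) (restrict x (side_info G j)) y" using x by blast
    from someI_ex[OF this] have y: "y \<in> messages (verts G) t" "\<phi> y = \<phi> x"
      "restrict y (side_info G j) = restrict x (side_info G j)"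
      unfolding y_def by blast+
    have "y j = x j"
    proof (rule dec[OF j y(1) x y(2)])
      show "y i = x i" if "i \<in> side_info G j" for i
        using y(3) that by (metis restrict_apply')
    qed
    then show ?thesis using ex unfolding \<psi>_def y_def by simp
  qed
  ultimately have "index_code G t r \<phi> \<psi>" using assms(1,2) unfolding index_code_def by auto
  then show ?thesis by blast
qed

lemma index_code_decodable:
  assumes "index_code G t r \<phi> \<psi>" "j \<in> verts G"
    and "x \<in> messages (verts G) t" "y \<in> messages (verts G) t" "\<phi> x = \<phi> y"
    and "\<And>i. i \<in> side_info G j \<Longrightarrow> x i = y i"
  shows "x j = y j"
proof -
  have "restrict x (side_info G j) = restrict y (side_info G j)"
    using assms(6) by (auto simp: restrict_def)
  then show ?thesis using assms(1-5) unfolding index_code_def by metis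
qed

text \<open>The same encoder works: tuples that agree on the larger side information agree on the
  smaller one.\<close>

lemma achievable_mono:
  assumes "achievable H R" "verts H = verts G"
    and "\<And>j. j \<in> verts G \<Longrightarrow> side_info H j \<subseteq> side_info G j"
  shows "achievable G R"
proof -
  from assms(1) obtain t r \<phi> \<psi> where code: "index_code H t r \<phi> \<psi>"
    and R: "\<forall>j\<in>verts H. R j \<le> real (t j) / real r" "R \<in> (\<Pi>\<^sub>E j\<in>verts H. {0..})"
    unfolding achievable_def by blast
  have "\<exists>\<psi>. index_code G t r \<phi> \<psi>"
  proof (rule index_codeI_decodable)
    show "r > 0" "\<phi> \<in> Pi (messages (verts G) t) (\<lambda>_. bits r)"
      using code assms(2) unfolding index_code_def by auto
    show "x j = y j" if "j \<in> verts G" "x \<in> messages (verts G) t" "y \<in> messages (verts G) t"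
      "\<phi> x = \<phi> y" "\<And>i. i \<in> side_info G j \<Longrightarrow> x i = y i" for j x y
      using index_code_decodable[OF code, of j x y] that assms(2,3) by auto
  qed
  with R assms(2) show ?thesis unfolding achievable_def by auto
qed

section \<open>Upper bound from acyclic sets, by counting\<close>

lemma finite_bits: "finite (bits k)" and card_bits: "card (bits k) = 2 ^ k"
  using finite_lists_length_eq[of "UNIV :: bool set" k] card_lists_length_eq[of "UNIV :: bool set" k]
  by (simp_all add: bits_def)

lemma card_messages:
  assumes "finite A"
  shows "card (messages A t) = 2 ^ (\<Sum>i\<in>A. t i)"
  using assms by (simp add: messages_def card_PiE card_bits power_sum)

text \<open>The list \<open>vs\<close> is a topological order: side information from inside it comes
  earlier in the list. With the other messages fixed, the encoder is therefore injective on the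
  messages of \<open>vs\<close>, and comparing cardinalities bounds the sum of their lengths by
  \<open>r\<close>.\<close>

lemma achievable_acyclic_sum_le:
  assumes R: "achievable G R"
    and vs: "distinct vs" "set vs \<subseteq> verts G"
    and acyc: "\<And>i. i < length vs \<Longrightarrow> side_info G (vs ! i) \<inter> set vs \<subseteq> set (take i vs)"
  shows "(\<Sum>j\<in>set vs. R j) \<le> 1"
proof -
  from R obtain t r \<phi> \<psi> where code: "index_code G t r \<phi> \<psi>"
    and Rt: "\<forall>j\<in>verts G. R j \<le> real (t j) / real r"
    unfolding achievable_def by blast
  from code have r: "r > 0" and \<phi>: "\<phi> \<in> Pi (messages (verts G) t) (\<lambda>_. bits r)"
    unfolding index_code_def by auto
  \<comment> \<open>Constant padding outside \<open>vs\<close> makes any two extended tuples agree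
    on side information from there.\<close>
  define ext where "ext x = (\<lambda>i\<in>verts G. if i \<in> set vs then x i else replicate (t i) False)"
    for x :: "'a \<Rightarrow> bool list"
  have ext: "ext x \<in> messages (verts G) t" if "x \<in> messages (set vs) t" for x
    using that by (auto simp: ext_def messages_def bits_def PiE_def Pi_def)
  have "inj_on (\<lambda>x. \<phi> (ext x)) (messages (set vs) t)"
  proof (rule inj_onI)
    fix x y assume x: "x \<in> messages (set vs) t" and y: "y \<in> messages (set vs) t"
      and eq: "\<phi> (ext x) = \<phi> (ext y)"
    have nth: "x (vs ! i) = y (vs ! i)" if "i < length vs" for i
      using that
    proof (induction i rule: less_induct)
      case (less i)
      have j: "vs ! i \<in> verts G" "vs ! i \<in> set vs" using less.prems vs(2) by auto
      have "ext x (vs ! i) = ext y (vs ! i)"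
      proof (rule index_code_decodable[OF code j(1), of "ext x" "ext y", OF ext[OF x] ext[OF y] eq])
        fix a assume a: "a \<in> side_info G (vs ! i)"
        show "ext x a = ext y a"
        proof (cases "a \<in> set vs")
          case True
          with a acyc[OF less.prems] have "a \<in> set (take i vs)" by blast
          then obtain l where "l < i" "l < length vs" "a = vs ! l"
            by (auto simp: in_set_conv_nth)
          with less.IH show ?thesis by (simp add: ext_def)
        qed (simp add: ext_def)
      qed
      with j show ?case by (simp add: ext_def)
    qed
    show "x = y"
    proof (rule PiE_ext)
      show "x \<in> (\<Pi>\<^sub>E i\<in>set vs. bits (t i))" "y \<in> (\<Pi>\<^sub>E i\<in>set vs. bits (t i))"
        using x y by (simp_all add: messages_def)
      show "x j = y j" if "j \<in> set vs" for j
        using that nth by (auto simp: in_set_conv_nth)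
    qed
  qed
  moreover have "(\<lambda>x. \<phi> (ext x)) ` messages (set vs) t \<subseteq> bits r"
    using \<phi> ext by (auto simp: Pi_def)
  ultimately have "card (messages (set vs) t) \<le> card (bits r)"
    using finite_bits by (rule card_inj_on_le)
  then have "(\<Sum>j\<in>set vs. t j) \<le> r"
    by (simp add: card_messages card_bits)
  then have le_r: "(\<Sum>j\<in>set vs. real (t j)) \<le> real r"
    by (metis of_nat_le_iff of_nat_sum)
  have "(\<Sum>j\<in>set vs. R j) \<le> (\<Sum>j\<in>set vs. real (t j) / real r)"
    using Rt vs(2) by (intro sum_mono) auto
  then have "(\<Sum>j\<in>set vs. R j) \<le> (\<Sum>j\<in>set vs. real (t j)) / real r"
    by (simp add: sum_divide_distrib)
  also have "\<dots> \<le> 1" using le_r r by simp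
  finally show ?thesis .
qed

text \<open>Two tuples with the same codeword agree either at all entries of \<open>vs\<close> or at
  none, since each sum ties neighbouring entries together. One piece of side information inside
  \<open>vs\<close> settles which case holds.\<close>

lemma achievable_consecutive_sums:
  assumes vs: "length vs \<ge> 2" "set vs \<subseteq> verts G"
    and nbr: "\<And>v. v \<in> set vs \<Longrightarrow> side_info G v \<inter> set vs \<noteq> {}"
  shows "achievable G (\<lambda>j\<in>verts G. if j \<in> set vs then 1 / real (length vs - 1) else 0)"
proof -
  define t :: "'a \<Rightarrow> nat" where "t j = (if j \<in> set vs then 1 else 0)" for j
  let ?r = "length vs - 1"
  \<comment> \<open>On booleans \<open>\<noteq>\<close> is addition modulo 2.\<close>
  define \<phi> where "\<phi> x = map (\<lambda>i. hd (x (vs ! i)) \<noteq> hd (x (vs ! Suc i))) [0..<?r]"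
    for x :: "'a \<Rightarrow> bool list"
  have "\<exists>\<psi>. index_code G t ?r \<phi> \<psi>"
  proof (rule index_codeI_decodable)
    show "?r > 0" using vs(1) by simp
    show "\<phi> \<in> Pi (messages (verts G) t) (\<lambda>_. bits ?r)" by (simp add: \<phi>_def bits_def)
    fix j x y
    assume j: "j \<in> verts G" and x: "x \<in> messages (verts G) t" and y: "y \<in> messages (verts G) t"
      and eq: "\<phi> x = \<phi> y" and side: "\<And>i. i \<in> side_info G j \<Longrightarrow> x i = y i"
    have len: "length (x j) = t j" "length (y j) = t j"
      using x y j by (auto simp: messages_def bits_def PiE_def Pi_def)
    show "x j = y j"
    proof (cases "j \<in> set vs")
      case True
      have step: "hd (x (vs ! i)) = hd (y (vs ! i)) \<longleftrightarrow> hd (x (vs ! Suc i)) = hd (y (vs ! Suc i))"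
        if "Suc i < length vs" for i
        using eq that by (auto simp: \<phi>_def)
      have all: "hd (x (vs ! i)) = hd (y (vs ! i)) \<longleftrightarrow> hd (x (vs ! 0)) = hd (y (vs ! 0))"
        if "i < length vs" for i
        using that by (induction i) (use step in auto)
      from nbr[OF True] obtain i where "i < length vs" "vs ! i \<in> side_info G j"
        by (auto simp: in_set_conv_nth)
      with side all have "hd (x (vs ! 0)) = hd (y (vs ! 0))" by metis
      with all True have "hd (x j) = hd (y j)" by (metis in_set_conv_nth)
      with len True show ?thesis
        by (auto simp: t_def length_Suc_conv)
    next
      case False
      with len show ?thesis by (simp add: t_def)
    qed
  qed
  moreover have "\<forall>j\<in>verts G. (\<lambda>j\<in>verts G. if j \<in> set vs then 1 / real ?r else 0) j \<le> real (t j) / real ?r"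
    by (simp add: t_def)
  moreover have "(\<lambda>j\<in>verts G. if j \<in> set vs then 1 / real ?r else 0) \<in> (\<Pi>\<^sub>E j\<in>verts G. {0..})"
    by simp
  ultimately show ?thesis unfolding achievable_def by blast
qed

section \<open>Passing to the closure\<close>

lemma achievable_in_capacity_region: "achievable G R \<Longrightarrow> R \<in> capacity_region G"
  unfolding capacity_region_def
  by (rule subsetD[OF closure_of_subset]) (auto simp: achievable_def PiE_def)

text \<open>The sum of finitely many coordinates is continuous in the product topology, so the bound
  cuts out a closed set and survives the closure.\<close>

lemma capacity_region_sum_le:
  assumes "S \<subseteq> verts G" "\<And>R. achievable G R \<Longrightarrow> (\<Sum>j\<in>S. R j) \<le> c" "finite S"
    and "R \<in> capacity_region G"
  shows "(\<Sum>j\<in>S. R j) \<le> c"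
proof -
  let ?X = "product_topology (\<lambda>_. euclideanreal) (verts G)"
  have "continuous_map ?X euclideanreal (\<lambda>R. \<Sum>j\<in>S. R j)"
    using assms(1,3) by (intro continuous_map_sum continuous_map_product_projection) auto
  then have "closedin ?X {R \<in> topspace ?X. (\<Sum>j\<in>S. R j) \<in> {..c}}"
    by (rule closedin_continuous_map_preimage) simp
  moreover have "{R. achievable G R} \<subseteq> {R \<in> topspace ?X. (\<Sum>j\<in>S. R j) \<in> {..c}}"
  proof
    fix R assume "R \<in> {R. achievable G R}"
    with assms(2)[of R] show "R \<in> {R \<in> topspace ?X. (\<Sum>j\<in>S. R j) \<in> {..c}}"
      by (auto simp: achievable_def PiE_def)
  qed
  ultimately show ?thesis
    using closure_of_minimal assms(4) unfolding capacity_region_def by blast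
qed

section \<open>Arc lists of cycles\<close>

lemma side_info_conv: "side_info G j = tail G ` {a \<in> arcs G. head G a = j}"
  by (auto simp: side_info_def arcs_ends_def arc_to_ends_def)

context pre_digraph
begin

lemma cas_nth_Suc:
  assumes "cas u p v" "Suc i < length p"
  shows "tail G (p ! Suc i) = head G (p ! i)"
  using assms
proof (induction u p v arbitrary: i rule: cas.induct)
  case (2 u e es v)
  then show ?case by (cases i; cases es) auto
qed simp

lemma cas_last:
  assumes "cas u p v" "p \<noteq> []"
  shows "head G (last p) = v"
  using assms by (induction u p v rule: cas.induct) auto

text \<open>A cyclic shift puts \<open>e\<close> first, so that the remaining arcs \<open>q\<close>
  form a walk from the head of \<open>e\<close> back to its tail.\<close>

lemma cycle_rotate_to:
  assumes "cycle p" "e \<in> set p"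
  obtains q where "cas (head G e) q (tail G e)" "distinct (map (head G) (e # q))"
    "set (e # q) = set p" "length (e # q) = length p"
proof -
  from assms(1) obtain u where u: "cas u p u" "distinct (tl (awalk_verts u p))" "p \<noteq> []"
    by (auto simp: cycle_def awalk_def)
  from assms(2) obtain p1 p2 where p: "p = p1 @ e # p2" by (meson split_list)
  \<comment> \<open>For a nonempty walk, the tail of \<open>awalk_verts\<close> is the list of heads
    of its arcs.\<close>
  have "distinct (map (head G) p)"
    using u by (simp add: awalk_verts_conv'[OF u(1)])
  moreover obtain w where w: "cas u p1 w" "cas w (e # p2) u" using u(1) p by auto
  have "cas (head G e) (p2 @ p1) (tail G e)"
  proof -
    have "cas x (r @ s) z" if "cas x r y" "cas y s z" for x r y s z
      using that by (induction x r y rule: cas.induct) auto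
    with w show ?thesis by auto
  qed
  ultimately show ?thesis using that[of "p2 @ p1"] by (auto simp: p)
qed

end

theorem theorem1:
  fixes n :: nat and G :: "(nat, 'e) pre_digraph" and e :: 'e
  assumes "n \<ge> 1"
    and "digraph G"
    and "verts G = {1..n}"
    and "e \<in> arcs G"
    and "\<exists>S\<subseteq>verts G. unicycle (G \<restriction> S) \<and> e \<in> arcs (G \<restriction> S)"
  shows "critical G e"
proof -
  let ?H = "pre_digraph.del_arc G e"
  note del [simp] = pre_digraph.del_arc_simps
  from assms(5) obtain S where S: "S \<subseteq> verts G" and uni: "unicycle (G \<restriction> S)"
    and e: "e \<in> arcs (G \<restriction> S)"
    by blast
  interpret I: pre_digraph "G \<restriction> S" .
  from uni obtain p where p: "I.cycle p" "length p \<ge> 2" "set p = arcs (G \<restriction> S)"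
      "tail (G \<restriction> S) ` set p = verts (G \<restriction> S)"
    unfolding unicycle_def by blast
  from e p(3) have "e \<in> set p" by blast
  from I.cycle_rotate_to[OF p(1) this] obtain q where
    cas: "I.cas (head G e) q (tail G e)" and dist: "distinct (map (head G) (e # q))"
    and q: "set (e # q) = arcs (G \<restriction> S)" and len: "length (e # q) \<ge> 2"
    unfolding induce_subgraph_head induce_subgraph_tail p(3) using p(2) by metis
  \<comment> \<open>Listing heads from \<open>e\<close> onwards makes \<open>e\<close> the arc from
    the last entry of \<open>vs\<close> to the first; every other arc of the cycle joins consecutive
    entries.\<close>
  define vs where "vs = map (head G) (e # q)"
  have "q \<noteq> []" using len by auto
  have nth_vs: "vs ! i = head G ((e # q) ! i)" if "i < length vs" for i
    using that unfolding vs_def by (metis length_map nth_map)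
  have tail_Suc: "tail G ((e # q) ! Suc i) = vs ! i" if i: "Suc i < length vs" for i
  proof -
    have "I.cas (tail G e) (e # q) (tail G e)" using cas by simp
    moreover have "Suc i < length (e # q)" using i by (simp add: vs_def)
    ultimately have "tail (G \<restriction> S) ((e # q) ! Suc i) = head (G \<restriction> S) ((e # q) ! i)"
      by (rule I.cas_nth_Suc)
    with nth_vs i show ?thesis by simp
  qed
  have tail_e: "tail G e = last vs"
    using I.cas_last[OF cas \<open>q \<noteq> []\<close>] \<open>q \<noteq> []\<close> by (simp add: vs_def last_map)
  have tails: "tail G a \<in> set vs" if "a \<in> set (e # q)" for a
  proof -
    from that obtain i where "i < length (e # q)" "(e # q) ! i = a"
      unfolding in_set_conv_nth by blast
    then have i: "a = (e # q) ! i" "i < length vs" by (simp_all add: vs_def)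
    show ?thesis
    proof (cases i)
      case 0
      with i(1) tail_e have "tail G a = last vs" by simp
      moreover have "vs \<noteq> []" using i(2) by auto
      ultimately show ?thesis by simp
    next
      case (Suc l)
      with i tail_Suc[of l] have "tail G a = vs ! l" by metis
      with Suc i(2) show ?thesis by simp
    qed
  qed
  have vs_S: "set vs = S"
  proof
    show "set vs \<subseteq> S" using q by (auto simp: vs_def)
    \<comment> \<open>The clause on tails in \<open>unicycle\<close> ensures that the cycle visits
      all of \<open>S\<close>.\<close>
    have "S = tail G ` set (e # q)" using p(4) unfolding p(3) q by simp
    with tails show "S \<subseteq> set vs" by (metis image_subsetI)
  qed
  have "distinct vs" using dist by (simp add: vs_def)
  have H_le: "(\<Sum>j\<in>set vs. R j) \<le> 1" if "R \<in> capacity_region ?H" for R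
  proof (rule capacity_region_sum_le[OF _ _ _ that])
    show sub: "set vs \<subseteq> verts ?H" using S vs_S by auto
    \<comment> \<open>As \<open>G \<restriction> S\<close> is a unicycle, an arc of \<open>G\<close>
      inside \<open>S\<close> lies on the cycle, and distinctness of heads fixes its position. Being
      different from \<open>e\<close> rules out position 0, so its tail is the preceding
      entry.\<close>
    have acyc: "side_info ?H (vs ! i) \<inter> set vs \<subseteq> set (take i vs)" if i: "i < length vs" for i
    proof
      fix v assume "v \<in> side_info ?H (vs ! i) \<inter> set vs"
      then obtain a where a: "a \<in> arcs G" "a \<noteq> e" "head G a = vs ! i" "tail G a = v" "v \<in> S"
        using vs_S by (auto simp: side_info_conv)
      moreover have "vs ! i \<in> S" using i vs_S by auto
      ultimately have "a \<in> set (e # q)" unfolding q by auto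
      then obtain l where l: "l < length (e # q)" "a = (e # q) ! l" unfolding in_set_conv_nth by blast
      then have "vs ! l = vs ! i" using a(3) nth_vs by (simp add: vs_def)
      with \<open>distinct vs\<close> i l have "l = i" by (simp add: nth_eq_iff_index_eq vs_def)
      with l a(2) obtain k where k: "i = Suc k" by (cases i) auto
      with tail_Suc[of k] i l \<open>l = i\<close> a(4) have "v = vs ! k" by metis
      then show "v \<in> set (take i vs)" using k i by (auto simp: in_set_conv_nth)
    qed
    show "(\<Sum>j\<in>set vs. R j) \<le> 1" if "achievable ?H R" for R
      using that \<open>distinct vs\<close> sub acyc by (rule achievable_acyclic_sum_le)
  qed simp
  have mono: "capacity_region ?H \<subseteq> capacity_region G"
  proof -
    have "side_info ?H j \<subseteq> side_info G j" for j by (auto simp: side_info_conv)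
    then have "{R. achievable ?H R} \<subseteq> {R. achievable G R}"
      using achievable_mono[of ?H _ G] by auto
    then show ?thesis unfolding capacity_region_def by (simp add: closure_of_mono)
  qed
  let ?R = "\<lambda>j\<in>verts G. if j \<in> set vs then 1 / real (length vs - 1) else 0"
  have len_vs: "length vs \<ge> 2" using len by (simp add: vs_def)
  have "achievable G ?R"
  proof (rule achievable_consecutive_sums)
    show "side_info G v \<inter> set vs \<noteq> {}" if v: "v \<in> set vs" for v
    proof -
      from v obtain a where a: "a \<in> set (e # q)" "head G a = v" by (auto simp: vs_def)
      with q have "a \<in> arcs G" by auto
      with a tails show ?thesis by (auto simp: side_info_conv)
    qed
  qed (use len_vs S vs_S in auto)
  then have "?R \<in> capacity_region G" by (rule achievable_in_capacity_region)
  moreover have "?R \<notin> capacity_region ?H"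
  proof
    assume "?R \<in> capacity_region ?H"
    \<comment> \<open>With k = \<open>length vs\<close> the left side is k / (k - 1). The bound k
      \<ge> 2 matters: for k = 1 division by zero would give 0.\<close>
    from H_le[OF this] have "(\<Sum>j\<in>set vs. 1 / real (length vs - 1)) \<le> 1"
      using S vs_S by (simp add: subset_iff cong: sum.cong)
    then show False
      using len_vs distinct_card[OF \<open>distinct vs\<close>] by (simp add: field_simps)
  qed
  ultimately show ?thesis using mono assms(4) unfolding critical_def by blast
qed

end
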